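(* Consider interval propagation on a finite database with a finite set of inequality rules and congruence rules (as defined in the context). Assume that every initial interval contains the true value of the corresponding invariant, that every true value is finite, and that every inequality and congruence condition used by the algorithm is valid for the true values. Then: (1) every interval produced by the inequality propagation steps and by congruence projection still contains the true value; (2) every run makes only finitely many strict endpoint updates; (3) a fair run reaches a common fixed point of all rules after finitely many steps; in particular, repeated complete sweeps through all rules terminate (a complete sweep occurs in which no endpoint changes). An arbitrary unfair run need not reach a common fixed point.
   Context: A database consists of finitely many knots $K$ and finitely many integer-valued invariants $X$. For each pair $(X,K)$ one stores an integer interval $[L_X(K),U_X(K)]\cap\mathbb Z$, whose endpoints may be infinite ($L_X\in\mathbb Z\cup\{-\infty\}$, $U_X\in\mathbb Z\cup\{+\infty\}$). The true value is the integer $X(K)$. The rules are of two kinds, applied for a fixed knot $K$: - Inequality propagation, for an inequality $X\ge Y$ in the rule set: $L_X\leftarrow\max\{L_X,L_Y\}$ and $U_Y\leftarrow\min\{U_Y,U_X\}$. - Congruence projection, for a congruence condition $X\equiv r \pmod m$ with $m\ge 1$ in the rule set: replace $[L_X,U_X]$ by the interval hull of $[L_X,U_X]\cap(r+m\mathbb Z)$, i.e. a finite lower endpoint is rounded up to the least admissible integer, a finite upper endpoint is rounded down to the greatest admissible integer, and infinite endpoints remain infinite. An empty intersection is reported as a contradiction. A rule is valid if the inequality $X(K)\ge Y(K)$ (resp. the congruence $X(K)\equiv r \pmod m$) holds for the true values. A run is a sequence of successive rule applications starting from the initial interval assignment; a strict endpoint update is an application step which changes some endpoint. A run (schedule) is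 fair if every rule is revisited indefinitely until termination. A complete sweep applies every rule once. A common fixed point is an assignment left unchanged by every rule. *)

theory Defs
  imports "HOL-Library.Extended" "HOL-Library.Extended_Nat" "HOL-Number_Theory.Cong"
begin

text \<open>
  \<open>Minf\<close> and \<open>Pinf\<close> are the two infinite endpoints. The type also contains pairs such as
  lower endpoint \<open>Pinf\<close>, which \<open>database\<close> below excludes.
\<close>
datatype interval = Interval (lower: "int extended") (upper: "int extended")

definition ints_of :: "interval \<Rightarrow> int set" where
  "ints_of I = {n. lower I \<le> Fin n \<and> Fin n \<le> upper I}"

type_synonym ('x, 'k) assignment = "'x \<Rightarrow> 'k \<Rightarrow> interval"

text \<open>
  A rule includes the knot to which it is applied: \<open>Inequality X Y K\<close> stands for
  \<open>X(K) \<ge> Y(K)\<close> and \<open>Congruence X r m K\<close> for \<open>X(K) \<equiv> r (mod m)\<close>. A rule that is used for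
  several knots is represented by one element for each of them.
\<close>
datatype ('x, 'k) rule =
    Inequality 'x 'x 'k
  | Congruence 'x int int 'k

fun rule_on :: "'k set \<Rightarrow> 'x set \<Rightarrow> ('x, 'k) rule \<Rightarrow> bool" where
  "rule_on Ks Xs (Inequality X Y K) \<longleftrightarrow> X \<in> Xs \<and> Y \<in> Xs \<and> K \<in> Ks"
| "rule_on Ks Xs (Congruence X r m K) \<longleftrightarrow> X \<in> Xs \<and> K \<in> Ks \<and> m \<ge> 1"

text \<open>Only the values of an assignment on \<open>Xs\<close> and \<open>Ks\<close> are meaningful.\<close>
definition database ::
  "'k set \<Rightarrow> 'x set \<Rightarrow> ('x, 'k) rule set \<Rightarrow> ('x, 'k) assignment \<Rightarrow> bool" where
  "database Ks Xs R A \<longleftrightarrow>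
     finite Ks \<and> finite Xs \<and> finite R \<and> (\<forall>\<rho>\<in>R. rule_on Ks Xs \<rho>) \<and>
     (\<forall>X\<in>Xs. \<forall>K\<in>Ks. lower (A X K) \<noteq> Pinf \<and> upper (A X K) \<noteq> Minf)"

definition contains_true_values ::
  "'k set \<Rightarrow> 'x set \<Rightarrow> ('x \<Rightarrow> 'k \<Rightarrow> int) \<Rightarrow> ('x, 'k) assignment \<Rightarrow> bool" where
  "contains_true_values Ks Xs val A \<longleftrightarrow> (\<forall>X\<in>Xs. \<forall>K\<in>Ks. val X K \<in> ints_of (A X K))"

fun valid_rule :: "('x \<Rightarrow> 'k \<Rightarrow> int) \<Rightarrow> ('x, 'k) rule \<Rightarrow> bool" where
  "valid_rule val (Inequality X Y K) \<longleftrightarrow> val X K \<ge> val Y K"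
| "valid_rule val (Congruence X r m K) \<longleftrightarrow> [val X K = r] (mod m)"

fun round_up :: "int \<Rightarrow> int \<Rightarrow> int extended \<Rightarrow> int extended" where
  "round_up r m (Fin a) = Fin (LEAST n. a \<le> n \<and> [n = r] (mod m))"
| "round_up r m Pinf = Pinf"
| "round_up r m Minf = Minf"

fun round_down :: "int \<Rightarrow> int \<Rightarrow> int extended \<Rightarrow> int extended" where
  "round_down r m (Fin b) = Fin (GREATEST n. n \<le> b \<and> [n = r] (mod m))"
| "round_down r m Pinf = Pinf"
| "round_down r m Minf = Minf"

definition set_entry ::
  "'x \<Rightarrow> 'k \<Rightarrow> interval \<Rightarrow> ('x, 'k) assignment \<Rightarrow> ('x, 'k) assignment" where
  "set_entry X K I A = A(X := (A X)(K := I))"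

definition propagate :: "'x \<Rightarrow> 'x \<Rightarrow> 'k \<Rightarrow> ('x, 'k) assignment \<Rightarrow> ('x, 'k) assignment" where
  "propagate X Y K A =
    (let A' = set_entry X K (Interval (max (lower (A X K)) (lower (A Y K))) (upper (A X K))) A
     in set_entry Y K (Interval (lower (A' Y K)) (min (upper (A' Y K)) (upper (A' X K)))) A')"

text \<open>The result \<open>None\<close> reports a contradiction.\<close>
fun apply_rule :: "('x, 'k) rule \<Rightarrow> ('x, 'k) assignment \<Rightarrow> ('x, 'k) assignment option" where
  "apply_rule (Inequality X Y K) A = Some (propagate X Y K A)"
| "apply_rule (Congruence X r m K) A =
    (if ints_of (A X K) \<inter> {n. [n = r] (mod m)} = {} then None
     else Some (set_entry X K
       (Interval (round_up r m (lower (A X K))) (round_down r m (upper (A X K)))) A))"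

fun apply_rules ::
  "('x, 'k) rule list \<Rightarrow> ('x, 'k) assignment \<Rightarrow> ('x, 'k) assignment option" where
  "apply_rules [] A = Some A"
| "apply_rules (\<rho> # \<rho>s) A = Option.bind (apply_rule \<rho> A) (apply_rules \<rho>s)"

definition common_fixed_point :: "('x, 'k) rule set \<Rightarrow> ('x, 'k) assignment \<Rightarrow> bool" where
  "common_fixed_point R A \<longleftrightarrow> (\<forall>\<rho>\<in>R. apply_rule \<rho> A = Some A)"

text \<open>
  A run is finite or infinite: it has a length \<open>N\<close>, and \<open>\<sigma> i\<close> is the rule applied in step \<open>i\<close>
  for \<open>i < N\<close>. The values of \<open>\<sigma>\<close> from \<open>N\<close> on are irrelevant.
\<close>
definition is_run :: "('x, 'k) rule set \<Rightarrow> enat \<Rightarrow> (nat \<Rightarrow> ('x, 'k) rule) \<Rightarrow> bool" where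
  "is_run R N \<sigma> \<longleftrightarrow> (\<forall>i. enat i < N \<longrightarrow> \<sigma> i \<in> R)"

definition state_after ::
  "('x, 'k) assignment \<Rightarrow> (nat \<Rightarrow> ('x, 'k) rule) \<Rightarrow> nat \<Rightarrow> ('x, 'k) assignment option" where
  "state_after A0 \<sigma> n = apply_rules (map \<sigma> [0..<n]) A0"

definition strict_update ::
  "('x, 'k) assignment \<Rightarrow> (nat \<Rightarrow> ('x, 'k) rule) \<Rightarrow> nat \<Rightarrow> bool" where
  "strict_update A0 \<sigma> i \<longleftrightarrow>
     (\<exists>A B. state_after A0 \<sigma> i = Some A \<and> state_after A0 \<sigma> (Suc i) = Some B \<and>
       (\<exists>X K. lower (B X K) \<noteq> lower (A X K) \<or> upper (B X K) \<noteq> upper (A X K)))"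

text \<open>A run terminates at a contradiction or when no rule changes anything any more.\<close>
fun terminated :: "('x, 'k) rule set \<Rightarrow> ('x, 'k) assignment option \<Rightarrow> bool" where
  "terminated R None \<longleftrightarrow> True"
| "terminated R (Some A) \<longleftrightarrow> common_fixed_point R A"

text \<open>
  From every time on, each rule is applied again unless the run terminates first. In
  particular, an infinite run that applies every rule infinitely often is fair, and a finite
  run is fair only if it has terminated.
\<close>
definition fair ::
  "('x, 'k) rule set \<Rightarrow> ('x, 'k) assignment \<Rightarrow> enat \<Rightarrow> (nat \<Rightarrow> ('x, 'k) rule) \<Rightarrow> bool" where
  "fair R A0 N \<sigma> \<longleftrightarrow>
     (\<forall>\<rho>\<in>R. \<forall>i. enat i \<le> N \<longrightarrow>
       (\<exists>j\<ge>i. enat j < N \<and> \<sigma> j = \<rho> \<or>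
               enat j \<le> N \<and> terminated R (state_after A0 \<sigma> j)))"

definition complete_sweep :: "('x, 'k) rule set \<Rightarrow> ('x, 'k) rule list \<Rightarrow> bool" where
  "complete_sweep R \<rho>s \<longleftrightarrow> distinct \<rho>s \<and> set \<rho>s = R"

definition no_change_during ::
  "('x, 'k) rule list \<Rightarrow> ('x, 'k) assignment \<Rightarrow> bool" where
  "no_change_during \<rho>s A \<longleftrightarrow> (\<forall>i\<le>length \<rho>s. apply_rules (take i \<rho>s) A = Some A)"

end

theory Submission
  imports Defs
begin

text \<open>
  A valid rule never cuts a true value off: if
  \<open>X(K) \<ge> Y(K)\<close>, then \<open>L\<^sub>Y \<le> Y(K) \<le> X(K)\<close> and dually for the upper endpoints, and a true value in
  the residue class \<open>r + m\<int>\<close> cannot be skipped by rounding to the nearest member of that class.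
  Hence no contradiction is ever reported, and every rule application moves endpoints only
  towards the true value.

  The sum of all distances between endpoints and true values does not measure progress, since it
  stays infinite as long as one endpoint is infinite. Each single distance does: it lies in
  \<open>\<nat> \<union> {\<infinity>}\<close>, which is well-ordered, and it decreases strictly whenever its endpoint changes.
  Each endpoint therefore changes only finitely often, and there are finitely many of them. This is
  \<open>tightening_chain_stabilizes\<close>.

  That lemma is applied to two chains. The states of a run form one; past the point where it is
  constant, fairness makes every rule act on the same assignment and leave it unchanged. The
  states between successive sweeps form the other; once a sweep returns the assignment that it was
  given, all states within the sweep are squeezed between two equal assignments.
\<close>

section \<open>Rounding to a residue class\<close>

lemma cong_dist_ge:
  fixes n r a m :: int
  assumes "[n = r] (mod m)" and "a \<le> n" and "m \<ge> 1"
  shows "a + (r - a) mod m \<le> n"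
proof -
  have "(r - a) mod m = (n - a) mod m"
    using cong_diff[OF assms(1) cong_refl, of a] by (simp add: cong_def)
  also have "\<dots> \<le> n - a"
    using assms(2,3) by (intro zmod_le_nonneg_dividend) simp
  finally show ?thesis by simp
qed

text \<open>
  The integers are not well-ordered, so \<open>LEAST\<close> and \<open>GREATEST\<close> are usable only after a witness
  has been exhibited; the remainder supplies it.
\<close>

lemma round_up_Fin:
  assumes "m \<ge> 1"
  shows "round_up r m (Fin a) = Fin (a + (r - a) mod m)"
proof -
  have "(LEAST n. a \<le> n \<and> [n = r] (mod m)) = a + (r - a) mod m"
  proof (intro Least_equality conjI)
    show "a \<le> a + (r - a) mod m"
      using assms by simp
    show "[a + (r - a) mod m = r] (mod m)"
      by (simp add: cong_def mod_add_right_eq)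
  qed (use assms cong_dist_ge in blast)
  then show ?thesis by simp
qed

lemma round_down_Fin:
  assumes "m \<ge> 1"
  shows "round_down r m (Fin b) = Fin (b - (b - r) mod m)"
proof -
  have le: "n \<le> b - (b - r) mod m" if "n \<le> b" "[n = r] (mod m)" for n
    \<comment> \<open>reflection at \<open>0\<close> turns rounding down into rounding up\<close>
    using cong_dist_ge[of "-n" "-r" m "-b"] that assms by (simp add: cong_minus_minus_iff)
  have "(GREATEST n. n \<le> b \<and> [n = r] (mod m)) = b - (b - r) mod m"
  proof (intro Greatest_equality conjI)
    show "b - (b - r) mod m \<le> b"
      using assms by simp
    show "[b - (b - r) mod m = r] (mod m)"
      by (simp add: cong_def mod_diff_right_eq)
  qed (use le in blast)
  then show ?thesis by simp
qed

lemma round_up_increases: "m \<ge> 1 \<Longrightarrow> a \<le> round_up r m a"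
  by (cases a) (simp_all add: round_up_Fin del: round_up.simps(1))

lemma round_down_decreases: "m \<ge> 1 \<Longrightarrow> round_down r m b \<le> b"
  by (cases b) (simp_all add: round_down_Fin del: round_down.simps(1))

lemma round_up_le_member:
  assumes "m \<ge> 1" and "[v = r] (mod m)" and "a \<le> Fin v"
  shows "round_up r m a \<le> Fin v"
  using assms by (cases a) (simp_all add: round_up_Fin cong_dist_ge del: round_up.simps(1))

lemma round_down_ge_member:
  assumes "m \<ge> 1" and "[v = r] (mod m)" and "Fin v \<le> b"
  shows "Fin v \<le> round_down r m b"
proof (cases b)
  case (Fin c)
  then show ?thesis
    using assms cong_dist_ge[of "-v" "-r" m "-c"]
    by (simp add: round_down_Fin cong_minus_minus_iff del: round_down.simps(1))
qed (use assms in simp_all)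


section \<open>Descent of the endpoints\<close>

lemma wellorder_descent_eventually_constant:
  fixes f :: "nat \<Rightarrow> 'a :: wellorder"
  assumes "\<And>n. f (Suc n) \<le> f n"
  shows "\<forall>\<^sub>F n in sequentially. f (Suc n) = f n"
proof -
  obtain n where n: "f n = (LEAST y. y \<in> range f)"
    by (metis LeastI rangeE rangeI)
  have "f k = f n" if "k \<ge> n" for k
  proof (rule antisym)
    show "f k \<le> f n"
      using lift_Suc_antimono_le[of f, OF assms that] .
    show "f n \<le> f k"
      unfolding n by (rule Least_le) simp
  qed
  then have "\<forall>k\<ge>n. f (Suc k) = f k"
    by (metis le_SucI)
  then show ?thesis
    unfolding eventually_sequentially ..
qed

text \<open>An infinite endpoint is at distance \<open>\<infinity>\<close> from the true value, whichever side it is on.\<close>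
definition distance :: "int \<Rightarrow> int extended \<Rightarrow> enat" where
  "distance v e = (case e of Fin a \<Rightarrow> enat (nat \<bar>v - a\<bar>) | _ \<Rightarrow> \<infinity>)"

lemma distance_lower:
  assumes "a \<le> b" and "b \<le> Fin v"
  shows "distance v b \<le> distance v a" and "distance v b = distance v a \<longleftrightarrow> b = a"
  using assms by (cases a; cases b; auto simp: distance_def)+

lemma distance_upper:
  assumes "b \<le> a" and "Fin v \<le> b"
  shows "distance v b \<le> distance v a" and "distance v b = distance v a \<longleftrightarrow> b = a"
  using assms by (cases a; cases b; auto simp: distance_def)+

lemma lower_endpoint_stabilizes:
  fixes e :: "nat \<Rightarrow> int extended"
  assumes "\<And>n. e n \<le> e (Suc n)" and "\<And>n. e n \<le> Fin v"
  shows "\<forall>\<^sub>F n in sequentially. e (Suc n) = e n"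
  using wellorder_descent_eventually_constant[of "\<lambda>n. distance v (e n)"]
  by (simp add: distance_lower assms)

lemma upper_endpoint_stabilizes:
  fixes e :: "nat \<Rightarrow> int extended"
  assumes "\<And>n. e (Suc n) \<le> e n" and "\<And>n. Fin v \<le> e n"
  shows "\<forall>\<^sub>F n in sequentially. e (Suc n) = e n"
  using wellorder_descent_eventually_constant[of "\<lambda>n. distance v (e n)"]
  by (simp add: distance_upper assms)


section \<open>Rule applications tighten an assignment\<close>

lemma apply_rules_append:
  "apply_rules (xs @ ys) A = Option.bind (apply_rules xs A) (apply_rules ys)"
  by (induction xs arbitrary: A) (auto simp: Option.bind_assoc intro!: Option.bind_cong)

lemma state_after_0 [simp]: "state_after A \<sigma> 0 = Some A"
  by (simp add: state_after_def)

lemma state_after_Suc: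
  "state_after A \<sigma> (Suc n) = Option.bind (state_after A \<sigma> n) (apply_rule (\<sigma> n))"
proof -
  have "apply_rules [] = (Some :: ('a, 'b) assignment \<Rightarrow> _)"
    by (rule ext) simp
  then show ?thesis
    by (auto simp: state_after_def apply_rules_append intro!: Option.bind_cong)
qed

text \<open>
  Entries outside \<open>Xs\<close> and \<open>Ks\<close> are required to agree: there may be infinitely many of them, and
  no true value bounds them.
\<close>
definition tightens ::
  "'k set \<Rightarrow> 'x set \<Rightarrow> ('x, 'k) assignment \<Rightarrow> ('x, 'k) assignment \<Rightarrow> bool" where
  "tightens Ks Xs A B \<longleftrightarrow>
     (\<forall>X K. lower (A X K) \<le> lower (B X K) \<and> upper (B X K) \<le> upper (A X K) \<and>
            (X \<in> Xs \<and> K \<in> Ks \<or> B X K = A X K))"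

lemma tightens_refl: "tightens Ks Xs A A"
  by (simp add: tightens_def)

lemma tightens_trans: "tightens Ks Xs A B \<Longrightarrow> tightens Ks Xs B C \<Longrightarrow> tightens Ks Xs A C"
  unfolding tightens_def by (metis order_trans)

lemma tightens_antisym:
  assumes "tightens Ks Xs A B" and "tightens Ks Xs B A"
  shows "A = B"
  using assms by (intro ext interval.expand) (auto simp: tightens_def intro: antisym)

lemma tightening_chain_stabilizes:
  assumes fin: "finite Xs" "finite Ks"
    and true: "\<And>n. contains_true_values Ks Xs val (S n)"
    and step: "\<And>n. tightens Ks Xs (S n) (S (Suc n))"
  shows "\<exists>n. \<forall>m\<ge>n. S m = S n"
proof -
  have "\<forall>\<^sub>F n in sequentially. S (Suc n) X K = S n X K" if "X \<in> Xs" "K \<in> Ks" for X K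
  proof -
    have bounds: "lower (S n X K) \<le> Fin (val X K)" "Fin (val X K) \<le> upper (S n X K)" for n
      using true[of n] that by (auto simp: contains_true_values_def ints_of_def)
    have steps: "lower (S n X K) \<le> lower (S (Suc n) X K)"
      "upper (S (Suc n) X K) \<le> upper (S n X K)" for n
      using step[of n] by (auto simp: tightens_def)
    from lower_endpoint_stabilizes[of "\<lambda>n. lower (S n X K)", OF steps(1) bounds(1)]
      upper_endpoint_stabilizes[of "\<lambda>n. upper (S n X K)", OF steps(2) bounds(2)]
    show ?thesis
      by eventually_elim (simp add: interval.expand)
  qed
  then have "\<forall>\<^sub>F n in sequentially. \<forall>X\<in>Xs. \<forall>K\<in>Ks. S (Suc n) X K = S n X K"
    using fin by (simp add: eventually_ball_finite_distrib)
  then have "\<forall>\<^sub>F n in sequentially. S (Suc n) = S n"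
  proof eventually_elim
    case (elim n)
    then show ?case
      using step[of n] by (intro ext) (auto simp: tightens_def)
  qed
  then obtain n where n: "S (Suc m) = S m" if "m \<ge> n" for m
    by (auto simp: eventually_sequentially)
  have "S m = S n" if "m \<ge> n" for m
    using that by (induction rule: dec_induct) (simp_all add: n)
  then show ?thesis by blast
qed

lemma propagate_tightens:
  assumes "X \<in> Xs" "Y \<in> Xs" "K \<in> Ks"
  shows "tightens Ks Xs A (propagate X Y K A)"
  using assms by (auto simp: tightens_def propagate_def set_entry_def)

lemma propagate_contains_true_values:
  assumes "val X K \<ge> val Y K" "X \<in> Xs" "Y \<in> Xs" "K \<in> Ks"
    and "contains_true_values Ks Xs val A"
  shows "contains_true_values Ks Xs val (propagate X Y K A)"
proof -
  have "lower (A X K) \<le> Fin (val X K)" "Fin (val X K) \<le> upper (A X K)"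
    "lower (A Y K) \<le> Fin (val Y K)" "Fin (val Y K) \<le> upper (A Y K)"
    using assms by (auto simp: contains_true_values_def ints_of_def)
  moreover from this assms(1)
  have "lower (A Y K) \<le> Fin (val X K)" "Fin (val Y K) \<le> upper (A X K)"
    using order_trans[of _ "Fin (val Y K)" "Fin (val X K)"]
      order_trans[of "Fin (val Y K)" "Fin (val X K)"] by simp_all
  ultimately show ?thesis
    using assms(5)
    by (auto simp: contains_true_values_def ints_of_def propagate_def set_entry_def)
qed

lemma apply_rule_sound:
  assumes "rule_on Ks Xs \<rho>" and "valid_rule val \<rho>" and "contains_true_values Ks Xs val A"
  shows "\<exists>B. apply_rule \<rho> A = Some B \<and> contains_true_values Ks Xs val B \<and> tightens Ks Xs A B"
proof (cases \<rho>)
  case (Inequality X Y K)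
  then show ?thesis
    using assms by (simp add: propagate_tightens propagate_contains_true_values)
next
  case (Congruence X r m K)
  then have rule: "X \<in> Xs" "K \<in> Ks" "m \<ge> 1" "[val X K = r] (mod m)"
    using assms by auto
  then have "val X K \<in> ints_of (A X K)"
    using assms by (simp add: contains_true_values_def)
  with rule have consistent: "ints_of (A X K) \<inter> {n. [n = r] (mod m)} \<noteq> {}"
    by blast
  let ?B = "set_entry X K
    (Interval (round_up r m (lower (A X K))) (round_down r m (upper (A X K)))) A"
  have "contains_true_values Ks Xs val ?B"
    using assms(3) rule
    by (auto simp: contains_true_values_def ints_of_def set_entry_def
        intro: round_up_le_member round_down_ge_member)
  moreover have "tightens Ks Xs A ?B"
    using rule
    by (auto simp: tightens_def set_entry_def intro: round_up_increases round_down_decreases)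
  ultimately show ?thesis
    using consistent Congruence by simp
qed

lemma apply_rules_sound:
  assumes "\<forall>\<rho>\<in>set \<rho>s. rule_on Ks Xs \<rho> \<and> valid_rule val \<rho>"
    and "contains_true_values Ks Xs val A"
  shows "\<exists>B. apply_rules \<rho>s A = Some B \<and> contains_true_values Ks Xs val B \<and> tightens Ks Xs A B"
  using assms
proof (induction \<rho>s arbitrary: A)
  case Nil
  then show ?case by (simp add: tightens_refl)
next
  case (Cons \<rho> \<rho>s)
  obtain B where B: "apply_rule \<rho> A = Some B" "contains_true_values Ks Xs val B"
    "tightens Ks Xs A B"
    using apply_rule_sound[of Ks Xs \<rho> val A] Cons.prems by auto
  with Cons.IH[of B] Cons.prems show ?case
    by (auto intro: tightens_trans)
qed


section \<open>Runs and sweeps\<close>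

locale valid_database =
  fixes Ks :: "'k set" and Xs :: "'x set" and R :: "('x, 'k) rule set"
    and val :: "'x \<Rightarrow> 'k \<Rightarrow> int" and A0 :: "('x, 'k) assignment"
  assumes database: "database Ks Xs R A0"
    and true_values: "contains_true_values Ks Xs val A0"
    and valid: "\<forall>\<rho>\<in>R. valid_rule val \<rho>"
begin

lemma rule_list_sound:
  assumes "set \<rho>s \<subseteq> R" and "contains_true_values Ks Xs val A"
  shows "\<exists>B. apply_rules \<rho>s A = Some B \<and> contains_true_values Ks Xs val B \<and> tightens Ks Xs A B"
  using assms database valid by (intro apply_rules_sound) (auto simp: database_def)

lemma run_sound:
  assumes "is_run R N \<sigma>" and "enat n \<le> N"
  shows "\<exists>A. state_after A0 \<sigma> n = Some A \<and> contains_true_values Ks Xs val A"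
proof -
  have "enat i < N" if "i < n" for i
    using that assms(2) by (meson enat_ord_simps(2) less_le_trans)
  then have "set (map \<sigma> [0..<n]) \<subseteq> R"
    using assms(1) by (auto simp: is_run_def)
  from rule_list_sound[OF this true_values] show ?thesis
    by (auto simp: state_after_def)
qed

lemma run_stabilizes:
  assumes run: "is_run R N \<sigma>"
  shows "\<exists>n. enat n \<le> N \<and>
    (\<forall>m\<ge>n. enat m \<le> N \<longrightarrow> state_after A0 \<sigma> m = state_after A0 \<sigma> n)"
proof (cases N)
  case (enat n)
  then show ?thesis by (intro exI[of _ n]) auto
next
  case infinity
  define S where "S n = the (state_after A0 \<sigma> n)" for n
  have S: "state_after A0 \<sigma> n = Some (S n)" "contains_true_values Ks Xs val (S n)" for n
    using run_sound[OF run, of n] infinity by (auto simp: S_def)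
  have "tightens Ks Xs (S n) (S (Suc n))" for n
    using rule_list_sound[of "[\<sigma> n]" "S n"] S[of n] S[of "Suc n"] run infinity
    by (auto simp: state_after_Suc is_run_def)
  moreover have "finite Xs" "finite Ks"
    using database by (auto simp: database_def)
  ultimately obtain n where "\<forall>m\<ge>n. S m = S n"
    using tightening_chain_stabilizes[of Xs Ks val S] S(2) by blast
  then have "\<forall>m\<ge>n. state_after A0 \<sigma> m = state_after A0 \<sigma> n"
    unfolding S(1) by blast
  moreover have "enat n \<le> N"
    using infinity by simp
  ultimately show ?thesis by blast
qed

lemma finitely_many_strict_updates:
  assumes run: "is_run R N \<sigma>"
  shows "finite {i. enat i < N \<and> strict_update A0 \<sigma> i}"
proof -
  obtain n where n: "state_after A0 \<sigma> m = state_after A0 \<sigma> n" if "m \<ge> n" "enat m \<le> N" for m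
    using run_stabilizes[OF run] by blast
  have "i < n" if i: "enat i < N" "strict_update A0 \<sigma> i" for i
  proof (rule ccontr)
    assume "\<not> i < n"
    then have "state_after A0 \<sigma> (Suc i) = state_after A0 \<sigma> i"
      using n[of i] n[of "Suc i"] i(1) by (simp add: Suc_ile_eq)
    with i(2) show False by (auto simp: strict_update_def)
  qed
  then have "{i. enat i < N \<and> strict_update A0 \<sigma> i} \<subseteq> {..<n}" by blast
  then show ?thesis by (rule finite_subset) simp
qed

lemma fair_run_reaches_fixed_point:
  assumes run: "is_run R N \<sigma>" and fair: "fair R A0 N \<sigma>"
  shows "\<exists>n A. enat n \<le> N \<and> state_after A0 \<sigma> n = Some A \<and> common_fixed_point R A"
proof (rule ccontr)
  assume no_fixed_point: "\<not> ?thesis"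
  have not_terminated: "\<not> terminated R (state_after A0 \<sigma> j)" if j: "enat j \<le> N" for j
  proof -
    obtain A where "state_after A0 \<sigma> j = Some A"
      using run_sound[OF run j] by blast
    then show ?thesis
      using no_fixed_point j by simp
  qed
  obtain n where n: "enat n \<le> N"
    and stable: "\<forall>m\<ge>n. enat m \<le> N \<longrightarrow> state_after A0 \<sigma> m = state_after A0 \<sigma> n"
    using run_stabilizes[OF run] by blast
  obtain A where A: "state_after A0 \<sigma> n = Some A"
    using run_sound[OF run n] by blast
  \<comment> \<open>every rule is applied once more after step \<open>n\<close>, where it acts on \<open>A\<close> and returns \<open>A\<close>\<close>
  have "apply_rule \<rho> A = Some A" if "\<rho> \<in> R" for \<rho>
  proof -
    obtain j where j: "j \<ge> n" "enat j < N" "\<sigma> j = \<rho>"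
      using fair \<open>\<rho> \<in> R\<close> n not_terminated unfolding fair_def by meson
    then show ?thesis
      using stable[rule_format, of j] stable[rule_format, of "Suc j"] A
      by (simp add: state_after_Suc Suc_ile_eq)
  qed
  then show False
    using no_fixed_point n A by (auto simp: common_fixed_point_def)
qed

text \<open>
  That a sweep as a whole returns its input does not by itself exclude changes that are undone
  within the sweep; tightening does, because it is antisymmetric.
\<close>
lemma sweeps_terminate:
  assumes sweeps: "\<And>n. set (sw n) \<subseteq> R"
  shows "\<exists>n A. apply_rules (concat (map sw [0..<n])) A0 = Some A \<and> no_change_during (sw n) A"
proof -
  let ?state = "\<lambda>n. apply_rules (concat (map sw [0..<n])) A0"
  define S where "S n = the (?state n)" for n
  have "set (concat (map sw [0..<n])) \<subseteq> R" for n
    using sweeps by auto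
  then have S: "?state n = Some (S n)" "contains_true_values Ks Xs val (S n)" for n
    using rule_list_sound[OF _ true_values, of "concat (map sw [0..<n])"]
    by (auto simp: S_def)
  have sweep: "apply_rules (sw n) (S n) = Some (S (Suc n))" for n
    using S(1)[of n] S(1)[of "Suc n"] by (simp add: apply_rules_append)
  have "tightens Ks Xs (S n) (S (Suc n))" for n
    using rule_list_sound[OF sweeps S(2), of n n] sweep[of n] by auto
  moreover have "finite Xs" "finite Ks"
    using database by (auto simp: database_def)
  ultimately obtain n where n: "\<forall>m\<ge>n. S m = S n"
    using tightening_chain_stabilizes[of Xs Ks val S] S(2) by blast
  have "S (Suc n) = S n"
    by (rule n[rule_format]) simp
  then have idle: "apply_rules (sw n) (S n) = Some (S n)"
    using sweep[of n] by simp
  have "apply_rules (take i (sw n)) (S n) = Some (S n)" for i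
  proof -
    have "set (take i (sw n)) \<subseteq> R" "set (drop i (sw n)) \<subseteq> R"
      using sweeps[of n] by (auto dest: in_set_takeD in_set_dropD)
    then obtain B C
      where B: "apply_rules (take i (sw n)) (S n) = Some B" "tightens Ks Xs (S n) B"
      and C: "apply_rules (drop i (sw n)) B = Some C" "tightens Ks Xs B C"
      using rule_list_sound S(2) by metis
    have "C = S n"
      using idle B(1) C(1) apply_rules_append[of "take i (sw n)" "drop i (sw n)" "S n"] by simp
    with B C show ?thesis
      using tightens_antisym by blast
  qed
  then show ?thesis
    using S(1) unfolding no_change_during_def by blast
qed

end


section \<open>An unfair run\<close>

text \<open>
  The rules say \<open>X\<^sub>0 = X\<^sub>1\<close> as two inequalities. The initial intervals \<open>[0, \<infinity>)\<close> for \<open>X\<^sub>0\<close> and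
  \<open>(-\<infinity>, 0]\<close> for \<open>X\<^sub>1\<close> already satisfy \<open>X\<^sub>0 \<ge> X\<^sub>1\<close>, so a run that applies only this inequality never
  moves, although the other one would shrink both intervals to \<open>{0}\<close>.
\<close>
lemma unfair_run_without_fixed_point:
  "\<exists>(K' :: nat) (Xs' :: nat set) R' val' A0' \<sigma>.
     database {K'} Xs' R' A0' \<and> contains_true_values {K'} Xs' val' A0' \<and>
     (\<forall>\<rho>\<in>R'. valid_rule val' \<rho>) \<and>
     is_run R' \<infinity> \<sigma> \<and> \<not> fair R' A0' \<infinity> \<sigma> \<and>
     (\<forall>n A. state_after A0' \<sigma> n = Some A \<longrightarrow> \<not> common_fixed_point R' A)"
proof -
  define R where "R = {Inequality 0 1 0, Inequality (1 :: nat) 0 (0 :: nat)}"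
  define A :: "(nat, nat) assignment" where
    "A = (\<lambda>X K. if X = 0 then Interval (Fin 0) Pinf else Interval Minf (Fin 0))"
  define \<sigma> :: "nat \<Rightarrow> (nat, nat) rule" where "\<sigma> = (\<lambda>_. Inequality 0 1 0)"
  interpret valid_database "{0}" "{0, 1}" R "\<lambda>_ _. 0" A
    by standard
      (auto simp: database_def contains_true_values_def ints_of_def R_def A_def)
  have run: "is_run R (\<infinity> :: enat) \<sigma>"
    by (simp add: is_run_def R_def \<sigma>_def)
  have idle: "apply_rule (Inequality 0 1 0) A = Some A"
    by (auto simp: A_def propagate_def set_entry_def fun_eq_iff max_def min_def)
  have state: "state_after A \<sigma> n = Some A" for n
    by (induction n) (simp_all add: state_after_Suc \<sigma>_def idle del: apply_rule.simps One_nat_def)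
  have "upper (propagate 1 0 0 A 0 0) \<noteq> upper (A 0 0)"
    by (simp add: A_def propagate_def set_entry_def min_def)
  then have not_fixed: "\<not> common_fixed_point R A"
    by (auto simp: common_fixed_point_def R_def)
  then have "\<not> fair R A (\<infinity> :: enat) \<sigma>"
    using fair_run_reaches_fixed_point[OF run] state by auto
  then show ?thesis
    using database true_values valid run state not_fixed
    by (intro exI[of _ 0] exI[of _ "{0, 1}"] exI[of _ R] exI[of _ "\<lambda>_ _. 0"] exI[of _ A]
        exI[of _ \<sigma>]) auto
qed


section \<open>Convergence of interval propagation\<close>

theorem proposition4p1:
  fixes Ks :: "'k set" and Xs :: "'x set" and R :: "('x, 'k) rule set"
    and val :: "'x \<Rightarrow> 'k \<Rightarrow> int" and A0 :: "('x, 'k) assignment"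
  assumes "database Ks Xs R A0"
    and "contains_true_values Ks Xs val A0"
    and "\<forall>\<rho>\<in>R. valid_rule val \<rho>"
  shows "(\<forall>N \<sigma>. is_run R N \<sigma> \<longrightarrow>
            (\<forall>n. enat n \<le> N \<longrightarrow>
              (\<exists>A. state_after A0 \<sigma> n = Some A \<and> contains_true_values Ks Xs val A)))
       \<and> (\<forall>N \<sigma>. is_run R N \<sigma> \<longrightarrow> finite {i. enat i < N \<and> strict_update A0 \<sigma> i})
       \<and> (\<forall>N \<sigma>. is_run R N \<sigma> \<and> fair R A0 N \<sigma> \<longrightarrow>
            (\<exists>n A. enat n \<le> N \<and> state_after A0 \<sigma> n = Some A \<and> common_fixed_point R A))
       \<and> (\<forall>sw :: nat \<Rightarrow> ('x, 'k) rule list. (\<forall>n. complete_sweep R (sw n)) \<longrightarrow>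
            (\<exists>n A. apply_rules (concat (map sw [0..<n])) A0 = Some A \<and>
                   no_change_during (sw n) A))
       \<and> (\<exists>(K' :: nat) (Xs' :: nat set) R' val' A0' \<sigma>.
            database {K'} Xs' R' A0' \<and> contains_true_values {K'} Xs' val' A0' \<and>
            (\<forall>\<rho>\<in>R'. valid_rule val' \<rho>) \<and>
            is_run R' \<infinity> \<sigma> \<and> \<not> fair R' A0' \<infinity> \<sigma> \<and>
            (\<forall>n A. state_after A0' \<sigma> n = Some A \<longrightarrow> \<not> common_fixed_point R' A))"
proof -
  interpret valid_database Ks Xs R val A0
    using assms by unfold_locales
  show ?thesis
  proof (intro conjI)
    show "\<forall>N \<sigma>. is_run R N \<sigma> \<longrightarrow>
            (\<forall>n. enat n \<le> N \<longrightarrow>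
              (\<exists>A. state_after A0 \<sigma> n = Some A \<and> contains_true_values Ks Xs val A))"
      using run_sound by blast
    show "\<forall>N \<sigma>. is_run R N \<sigma> \<longrightarrow> finite {i. enat i < N \<and> strict_update A0 \<sigma> i}"
      using finitely_many_strict_updates by blast
    show "\<forall>N \<sigma>. is_run R N \<sigma> \<and> fair R A0 N \<sigma> \<longrightarrow>
            (\<exists>n A. enat n \<le> N \<and> state_after A0 \<sigma> n = Some A \<and> common_fixed_point R A)"
      using fair_run_reaches_fixed_point by blast
    show "\<forall>sw :: nat \<Rightarrow> ('x, 'k) rule list. (\<forall>n. complete_sweep R (sw n)) \<longrightarrow>
            (\<exists>n A. apply_rules (concat (map sw [0..<n])) A0 = Some A \<and>
                   no_change_during (sw n) A)"
      using sweeps_terminate by (simp add: complete_sweep_def)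
  qed (rule unfair_run_without_fixed_point)
qed

end
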